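(* Let $G_1$ and $G_2$ be (vertex-disjoint) graphs of order at least $3$. If both $G_1$ and $G_2$ have property (P), then their join $G_1\vee G_2$ has property (P).
   Context: Graphs are finite and simple. For a graph $G$ on vertex set $\{1,\dots,n\}$, $S(G)$ is the set of real symmetric $n\times n$ matrices $A$ such that for all $i\ne j$, $A_{ij}\neq 0$ if and only if $ij\in E(G)$ (diagonal entries are unrestricted). $A(i)$ denotes the principal submatrix of $A$ obtained by deleting row and column $i$, and $m_A(0)$ the multiplicity of $0$ as an eigenvalue of $A$. A vertex $i$ is a P-vertex of $A$ if $m_{A(i)}(0)-m_A(0)=1$, and $P_\nu(A)$ is the number of P-vertices of $A$. $G$ has property (P) if there exists a nonsingular $A\in S(G)$ with $P_\nu(A)=n$ (equivalently, a nonsingular $A\in S(G)$ with $\det A(i)=0$ for all $i$, i.e. $A^{-1}$ has zero diagonal). The join $G_1\vee G_2$ of disjoint graphs has vertex set $V(G_1)\cup V(G_2)$ and edge set $E(G_1)\cup E(G_2)\cup\{uv: u\in V(G_1),\ v\in V(G_2)\}$. *)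

theory Defs
  imports
    "Jordan_Normal_Form.Char_Poly"
    "Graph_Theory.Pair_Digraph"
begin

text \<open>
  A finite simple graph is a \<^locale>\<open>pair_graph\<close>: an edge \<open>uv\<close> is represented by the two arcs
  \<open>(u, v)\<close> and \<open>(v, u)\<close>.
\<close>

definition graph_join :: "'a pair_pre_digraph \<Rightarrow> 'a pair_pre_digraph \<Rightarrow> 'a pair_pre_digraph" where
  "graph_join G H =
     \<lparr> pverts = pverts G \<union> pverts H,
       parcs = parcs G \<union> parcs H \<union> pverts G \<times> pverts H \<union> pverts H \<times> pverts G \<rparr>"

lemma pair_graph_graph_join:
  assumes "pair_graph G" and "pair_graph H" and "pverts G \<inter> pverts H = {}"
  shows "pair_graph (graph_join G H)"
proof -
  interpret G: pair_graph G by fact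
  interpret H: pair_graph H by fact
  have symG: "(v, u) \<in> parcs G" if "(u, v) \<in> parcs G" for u v
    using G.pair_sym_arcs that by (auto simp: symmetric_def elim: symE)
  have symH: "(v, u) \<in> parcs H" if "(u, v) \<in> parcs H" for u v
    using H.pair_sym_arcs that by (auto simp: symmetric_def elim: symE)
  show ?thesis
  proof
    show "symmetric (with_proj (graph_join G H))"
      unfolding symmetric_def
      by (rule symI) (auto simp: graph_join_def dest: symG symH)
  qed (use assms(3) G.pair_no_loops H.pair_no_loops in
      \<open>auto simp: graph_join_def G.pair_finite_verts H.pair_finite_verts
         G.pair_finite_arcs H.pair_finite_arcs
         dest: G.in_arcsD1 G.in_arcsD2 H.in_arcsD1 H.in_arcsD2\<close>)
qed

text \<open>
  The set \<open>S(G)\<close> for a graph whose vertices are numbered by a list: row and column \<open>i\<close> belong to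
  the vertex \<open>vs ! i\<close>.  Indices run from \<open>0\<close> to \<open>n - 1\<close>.
\<close>

definition sym_matrices :: "'a pair_pre_digraph \<Rightarrow> 'a list \<Rightarrow> real mat set" where
  "sym_matrices G vs =
     {A \<in> carrier_mat (length vs) (length vs).
        transpose_mat A = A \<and>
        (\<forall>i < length vs. \<forall>j < length vs.
           i \<noteq> j \<longrightarrow> (A $$ (i, j) \<noteq> 0 \<longleftrightarrow> (vs ! i, vs ! j) \<in> parcs G))}"

definition eigenvalue_mult :: "real mat \<Rightarrow> real \<Rightarrow> nat" where
  "eigenvalue_mult A x = Polynomial.order x (char_poly A)"

text \<open>The difference of multiplicities can be negative, so it is taken in the integers.\<close>

definition P_vertex :: "real mat \<Rightarrow> nat \<Rightarrow> bool" where
  "P_vertex A i \<longleftrightarrow>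
     int (eigenvalue_mult (mat_delete A i i) 0) - int (eigenvalue_mult A 0) = 1"

definition P_nu :: "real mat \<Rightarrow> nat" where
  "P_nu A = card {i. i < dim_row A \<and> P_vertex A i}"

text \<open>
  A graph with vertex set \<open>V\<close> is identified with a graph on \<open>{0..<card V}\<close> by numbering its
  vertices.  Renumbering permutes rows and columns of the matrices simultaneously, so the choice
  of the numbering is immaterial.
\<close>

definition has_property_P :: "'a pair_pre_digraph \<Rightarrow> bool" where
  "has_property_P G \<longleftrightarrow>
     (\<exists>vs. distinct vs \<and> set vs = pverts G \<and>
       (\<exists>A \<in> sym_matrices G vs. invertible_mat A \<and> P_nu A = card (pverts G)))"

end

theory Submission
  imports Defs
begin

text \<open>
  Let \<open>A\<close> and \<open>B\<close> witness property (P) for the two graphs; their inverses \<open>Q\<close> and \<open>R\<close> have zero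
  diagonal. As the orders are at least 3, there are vectors \<open>u\<close>, \<open>v\<close> without zero entries that are
  isotropic for the quadratic forms of \<open>Q\<close> and \<open>R\<close>. Joining \<open>A\<close> and \<open>B\<close> by the rank one block
  \<open>C = u v\<^sup>T\<close> then leaves the Schur complements unchanged: \<open>C R C\<^sup>T = 0\<close> and \<open>C\<^sup>T Q C = 0\<close>, so the
  diagonal blocks of the inverse are again \<open>Q\<close> and \<open>R\<close>.
\<close>

section \<open>P-vertices and the diagonal of the inverse\<close>

lemma char_poly_inverse_0:
  fixes A Q :: "'a :: field mat"
  assumes A: "A \<in> carrier_mat n n" and Q: "Q \<in> carrier_mat n n" and AQ: "A * Q = 1\<^sub>m n"
  shows "poly (char_poly A) 0 \<noteq> 0"
proof
  assume "poly (char_poly A) 0 = 0"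
  then obtain v where v: "v \<in> carrier_vec n" "v \<noteq> 0\<^sub>v n" "A *\<^sub>v v = 0 \<cdot>\<^sub>v v"
    using A eigenvalue_root_char_poly[OF A] by (auto simp: eigenvalue_def eigenvector_def)
  have "v = (Q * A) *\<^sub>v v"
    using mat_mult_left_right_inverse[OF A Q AQ] v by simp
  also have "\<dots> = Q *\<^sub>v (0 \<cdot>\<^sub>v v)"
    using A Q v by (simp flip: v(3))
  also have "\<dots> = 0\<^sub>v n"
    using Q v by (auto simp: scalar_prod_def)
  finally show False using v by simp
qed

lemma order_0_eq_1:
  fixes p :: "'a :: idom poly"
  assumes "coeff p 0 = 0" and "coeff p 1 \<noteq> 0"
  shows "Polynomial.order 0 p = 1"
proof -
  obtain q where q: "p = pCons 0 q"
    using assms(1) by (cases p) auto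
  have q0: "poly q 0 \<noteq> 0" using assms(2) q by (simp add: poly_0_coeff_0)
  have p: "p = [:- 0, 1:] ^ 1 * q" using q by simp
  have "Polynomial.order 0 p = Polynomial.order 0 ([:- 0, 1:] ^ 1 :: 'a poly) + Polynomial.order 0 q"
    unfolding p by (rule order_mult) (use q0 in auto)
  then show ?thesis using order_power_n_n[of "0::'a" 1] order_0I[OF q0] by simp
qed

text \<open>
  A P-vertex requires multiplicity exactly 1, so simplicity of the root must be shown. Let \<open>b\<close> be
  column \<open>i\<close> of the adjugate of \<open>X = t I - A\<close>; then \<open>X b\<close> is the characteristic polynomial \<open>c\<close> times
  \<open>e\<^sub>i\<close>, and \<open>b i\<close> is the characteristic polynomial of \<open>A(i)\<close>. If \<open>b i\<close> had a double root at 0,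
  the coefficients of degree 0 and 1 of \<open>X b = c e\<^sub>i\<close> would give \<open>|b(0)|\<^sup>2 = 0\<close> by the symmetry of
  \<open>A\<close>, although \<open>c(0) \<noteq> 0\<close>.
\<close>

lemma P_vertex_iff_inverse_diag:
  assumes A: "A \<in> carrier_mat n n" and sym: "transpose_mat A = A"
    and Q: "Q \<in> carrier_mat n n" and AQ: "A * Q = 1\<^sub>m n" and i: "i < n"
  shows "P_vertex A i \<longleftrightarrow> Q $$ (i, i) = 0"
proof -
  define X where "X = char_poly_matrix A"
  define c where "c = char_poly A"
  define p where "p = char_poly (mat_delete A i i)"
  define b where "b j = adj_mat X $$ (j, i)" for j
  have X: "X \<in> carrier_mat n n" using A by (simp add: X_def)
  have symA: "A $$ (k, j) = A $$ (j, k)" if "k < n" "j < n" for j k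
    using that A arg_cong[OF sym, of "\<lambda>M. M $$ (k, j)"] by simp
  have QA: "Q * A = 1\<^sub>m n" by (rule mat_mult_left_right_inverse[OF A Q AQ])
  have c0: "coeff c 0 \<noteq> 0"
    using char_poly_inverse_0[OF A Q AQ] by (simp add: c_def poly_0_coeff_0)
  \<comment> \<open>On the diagonal the cofactor sign is 1.\<close>
  have "b i = det (mat_delete X i i)"
    using X i by (simp add: b_def adj_mat_def cofactor_def)
  also have "mat_delete X i i = char_poly_matrix (mat_delete A i i)"
    by (rule eq_matI) (use A i in \<open>auto simp: X_def char_poly_matrix_def mat_delete_def\<close>)
  finally have bi: "b i = p" by (simp add: p_def char_poly_def)
  have Xkj: "X $$ (k, j) = [: - A $$ (k, j), if k = j then 1 else 0 :]" if "k < n" "j < n" for k j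
    using that A by (auto simp: X_def char_poly_matrix_def)
  have eq: "(\<Sum>j<n. X $$ (k, j) * b j) = (if k = i then c else 0)" if k: "k < n" for k
  proof -
    have "(X * adj_mat X) $$ (k, i) = (\<Sum>j<n. X $$ (k, j) * b j)"
      using X adj_mat(1)[OF X] k i by (simp add: scalar_prod_def b_def lessThan_atLeast0)
    then show ?thesis
      using adj_mat(2)[OF X] k i by (auto simp: c_def char_poly_def X_def)
  qed
  have eq0: "(\<Sum>j<n. A $$ (k, j) * coeff (b j) 0) = (if k = i then - coeff c 0 else 0)"
    if k: "k < n" for k
  proof -
    have "coeff (X $$ (k, j) * b j) 0 = - (A $$ (k, j) * coeff (b j) 0)" if "j < n" for j
      using k that by (simp add: Xkj coeff_mult_0)
    then have "coeff (\<Sum>j<n. X $$ (k, j) * b j) 0 = - (\<Sum>j<n. A $$ (k, j) * coeff (b j) 0)"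
      by (simp add: coeff_sum sum_negf)
    then show ?thesis unfolding eq[OF k] by (auto split: if_splits)
  qed
  have eq1: "coeff (b k) 0 - (\<Sum>j<n. A $$ (k, j) * coeff (b j) 1) = (if k = i then coeff c 1 else 0)"
    if k: "k < n" for k
  proof -
    have "coeff (X $$ (k, j) * b j) 1 =
        (if k = j then coeff (b j) 0 else 0) - A $$ (k, j) * coeff (b j) 1" if "j < n" for j
      using k that by (auto simp: Xkj)
    then have "coeff (\<Sum>j<n. X $$ (k, j) * b j) 1 =
        coeff (b k) 0 - (\<Sum>j<n. A $$ (k, j) * coeff (b j) 1)"
      using k by (simp add: coeff_sum sum_subtractf sum.delta)
    then show ?thesis unfolding eq[OF k] by (auto split: if_splits)
  qed
  \<comment> \<open>Multiplying \<open>eq0\<close> by \<open>Q\<close> from the left recovers the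
    vector of constant coefficients of \<open>b\<close> as \<open>- coeff c 0\<close> times column
    \<open>i\<close> of \<open>Q\<close>; entry \<open>i\<close> belongs to
    \<open>p\<close>.\<close>
  have p0: "coeff p 0 = - coeff c 0 * Q $$ (i, i)"
  proof -
    have QAij: "(\<Sum>k<n. Q $$ (i, k) * A $$ (k, j)) = (if i = j then 1 else 0)" if "j < n" for j
      using arg_cong[OF QA, of "\<lambda>M. M $$ (i, j)"] that i A Q
      by (simp add: scalar_prod_def lessThan_atLeast0)
    have "(\<Sum>k<n. Q $$ (i, k) * (\<Sum>j<n. A $$ (k, j) * coeff (b j) 0)) =
        (\<Sum>j<n. (\<Sum>k<n. Q $$ (i, k) * A $$ (k, j)) * coeff (b j) 0)"
      by (simp add: sum_distrib_left sum_distrib_right mult.assoc) (rule sum.swap)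
    also have "\<dots> = (\<Sum>j<n. if i = j then coeff (b j) 0 else 0)"
      by (intro sum.cong) (auto simp: QAij)
    also have "\<dots> = coeff p 0" using i bi by simp
    finally have "coeff p 0 = (\<Sum>k<n. Q $$ (i, k) * (\<Sum>j<n. A $$ (k, j) * coeff (b j) 0))" by simp
    also have "\<dots> = (\<Sum>k<n. if k = i then - coeff c 0 * Q $$ (i, k) else 0)"
      by (intro sum.cong) (auto simp: eq0)
    finally show ?thesis using i by simp
  qed
  have p1: "coeff p 1 \<noteq> 0" if "coeff p 0 = 0"
  proof
    assume "coeff p 1 = 0"
    \<comment> \<open>Pair \<open>eq1\<close> with the constant coefficients of \<open>b\<close>.
      Symmetry then moves \<open>A\<close> onto these coefficients, where \<open>eq0\<close> leaves
      only a multiple of \<open>coeff p 1\<close>.\<close>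
    have "(\<Sum>k<n. coeff (b k) 0 * (coeff (b k) 0 - (\<Sum>j<n. A $$ (k, j) * coeff (b j) 1))) =
        (\<Sum>k<n. if k = i then coeff c 1 * coeff (b k) 0 else 0)"
      by (intro sum.cong) (auto simp: eq1 simp del: One_nat_def)
    also have "\<dots> = 0" using i bi that by simp
    finally have "(\<Sum>k<n. (coeff (b k) 0)\<^sup>2) =
        (\<Sum>k<n. coeff (b k) 0 * (\<Sum>j<n. A $$ (k, j) * coeff (b j) 1))"
      by (simp add: right_diff_distrib sum_subtractf power2_eq_square)
    also have "\<dots> = (\<Sum>j<n. coeff (b j) 1 * (\<Sum>k<n. A $$ (k, j) * coeff (b k) 0))"
      by (simp add: sum_distrib_left ac_simps) (rule sum.swap)
    also have "\<dots> = (\<Sum>j<n. coeff (b j) 1 * (\<Sum>k<n. A $$ (j, k) * coeff (b k) 0))"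
      by (intro sum.cong refl arg_cong2[where f="(*)"]) (auto simp: symA)
    also have "\<dots> = (\<Sum>j<n. if j = i then - coeff c 0 * coeff (b j) 1 else 0)"
      by (intro sum.cong) (auto simp: eq0)
    also have "\<dots> = 0" using i bi \<open>coeff p 1 = 0\<close> by simp
    finally have "coeff (b k) 0 = 0" if "k < n" for k
      using that by (simp add: sum_nonneg_eq_0_iff)
    then show False using eq0[OF i] c0 by simp
  qed
  have "Polynomial.order 0 c = 0" using c0 by (intro order_0I) (simp add: poly_0_coeff_0)
  moreover have "Polynomial.order 0 p = 1 \<longleftrightarrow> coeff p 0 = 0"
  proof (cases "coeff p 0 = 0")
    case True
    then show ?thesis using order_0_eq_1[OF True p1] by simp
  next
    case False
    then have "Polynomial.order 0 p = 0" by (intro order_0I) (simp add: poly_0_coeff_0)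
    with False show ?thesis by simp
  qed
  moreover have "coeff p 0 = 0 \<longleftrightarrow> Q $$ (i, i) = 0" using p0 c0 by simp
  ultimately show ?thesis
    by (simp add: P_vertex_def eigenvalue_mult_def c_def p_def)
qed

lemma P_nu_eq_iff_inverse_diag:
  assumes A: "A \<in> carrier_mat n n" and "transpose_mat A = A"
    and "Q \<in> carrier_mat n n" and "A * Q = 1\<^sub>m n"
  shows "P_nu A = n \<longleftrightarrow> (\<forall>i<n. Q $$ (i, i) = 0)"
proof -
  define Z where "Z = {i. i < n \<and> Q $$ (i, i) = 0}"
  have "{i. i < dim_row A \<and> P_vertex A i} = Z"
    unfolding Z_def using A P_vertex_iff_inverse_diag[OF assms] by (intro Collect_cong) auto
  then have "P_nu A = card Z" by (simp add: P_nu_def)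
  moreover have "card Z = n \<longleftrightarrow> Z = {..<n}"
  proof
    assume "card Z = n"
    then show "Z = {..<n}" by (intro card_subset_eq) (auto simp: Z_def)
  qed simp
  moreover have "Z = {..<n} \<longleftrightarrow> (\<forall>i<n. Q $$ (i, i) = 0)" unfolding Z_def by blast
  ultimately show ?thesis by simp
qed

text \<open>Replaces eigenvalue multiplicities by an explicit inverse: from here on, a matrix with
  the right pattern and an inverse with zero diagonal are all that has to be produced.\<close>

lemma has_property_P_iff:
  "has_property_P G \<longleftrightarrow>
    (\<exists>vs A Q. distinct vs \<and> set vs = pverts G \<and> A \<in> sym_matrices G vs \<and>
      Q \<in> carrier_mat (length vs) (length vs) \<and> A * Q = 1\<^sub>m (length vs) \<and>
      (\<forall>i<length vs. Q $$ (i, i) = 0))" (is "_ = ?R")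
proof
  assume "has_property_P G"
  then obtain vs A where vs: "distinct vs" "set vs = pverts G" and A: "A \<in> sym_matrices G vs"
    and inv: "invertible_mat A" and P: "P_nu A = card (pverts G)"
    by (auto simp: has_property_P_def)
  define n where "n = length vs"
  have n: "card (pverts G) = n" using vs by (metis distinct_card n_def)
  have AC: "A \<in> carrier_mat n n" "transpose_mat A = A"
    using A by (auto simp: sym_matrices_def n_def)
  obtain Q where "inverts_mat A Q" "inverts_mat Q A"
    using inv by (auto simp: invertible_mat_def)
  then have AQ: "A * Q = 1\<^sub>m n" and QA: "Q * A = 1\<^sub>m (dim_row Q)"
    using AC by (auto simp: inverts_mat_def)
  \<comment> \<open>\<open>inverts_mat\<close> does not fix the shape of \<open>Q\<close>; its
    dimensions are read off from the two products.\<close>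
  have "dim_col Q = n" using arg_cong[OF AQ, of dim_col] by simp
  moreover have "dim_row Q = n" using arg_cong[OF QA, of dim_col] AC by simp
  ultimately have Q: "Q \<in> carrier_mat n n" by auto
  have "\<forall>i<n. Q $$ (i, i) = 0"
    using P_nu_eq_iff_inverse_diag[OF AC Q AQ] P n by simp
  then show ?R
    using vs A Q AQ unfolding n_def
    by (intro exI[of _ vs] exI[of _ A] exI[of _ Q] conjI)
next
  assume ?R
  then obtain vs A Q where vs: "distinct vs" "set vs = pverts G" and A: "A \<in> sym_matrices G vs"
    and Q: "Q \<in> carrier_mat (length vs) (length vs)" and AQ: "A * Q = 1\<^sub>m (length vs)"
    and diag: "\<forall>i<length vs. Q $$ (i, i) = 0" by blast
  have AC: "A \<in> carrier_mat (length vs) (length vs)" "transpose_mat A = A"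
    using A by (auto simp: sym_matrices_def)
  have "P_nu A = length vs"
    using P_nu_eq_iff_inverse_diag[OF AC Q AQ] diag by simp
  then have "P_nu A = card (pverts G)"
    using distinct_card[OF vs(1)] vs(2) by simp
  moreover have "inverts_mat A Q \<and> inverts_mat Q A"
    using AC Q AQ mat_mult_left_right_inverse[OF AC(1) Q AQ] by (simp add: inverts_mat_def)
  then have "invertible_mat A"
    unfolding invertible_mat_def using AC by (intro conjI exI[of _ Q]) auto
  ultimately show "has_property_P G"
    unfolding has_property_P_def using vs A by (intro exI[of _ vs] conjI bexI[of _ A])
qed

section \<open>Generic choice of points for polynomial functions\<close>

text \<open>Functions of \<open>x\<close> that are polynomial along every line; no two of them which are not
  identically zero have zero product, as one sees on a line joining two points of nonvanishing.\<close>

definition line_poly :: "(('i \<Rightarrow> 'a :: comm_ring_1) \<Rightarrow> 'a) \<Rightarrow> bool" where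
  "line_poly f \<longleftrightarrow> (\<forall>x y. \<exists>p. \<forall>t. f (\<lambda>i. x i + t * y i) = poly p t)"

lemma line_poly_const: "line_poly (\<lambda>x. c)"
  unfolding line_poly_def by (intro allI exI[of _ "[:c:]"]) simp

lemma line_poly_coord: "line_poly (\<lambda>x. x i)"
  unfolding line_poly_def by (intro allI, rule_tac x = "[:x i, y i:]" in exI) simp

lemma line_poly_add:
  assumes "line_poly f" and "line_poly g"
  shows "line_poly (\<lambda>x. f x + g x)"
  using assms unfolding line_poly_def by (metis poly_add)

lemma line_poly_mult:
  assumes "line_poly f" and "line_poly g"
  shows "line_poly (\<lambda>x. f x * g x)"
  using assms unfolding line_poly_def by (metis poly_mult)

lemma line_poly_sum:
  assumes "\<And>a. a \<in> I \<Longrightarrow> line_poly (f a)"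
  shows "line_poly (\<lambda>x. \<Sum>a\<in>I. f a x)"
  using assms by (induction I rule: infinite_finite_induct) (auto intro: line_poly_const line_poly_add)

lemma line_poly_prod:
  assumes "\<And>a. a \<in> I \<Longrightarrow> line_poly (f a)"
  shows "line_poly (\<lambda>x. \<Prod>a\<in>I. f a x)"
  using assms by (induction I rule: infinite_finite_induct) (auto intro: line_poly_const line_poly_mult)

lemma line_poly_common_nonzero:
  fixes f g :: "('i \<Rightarrow> 'a :: {idom, ring_char_0}) \<Rightarrow> 'a"
  assumes "line_poly f" and "line_poly g" and "f a \<noteq> 0" and "g b \<noteq> 0"
  shows "\<exists>x. f x * g x \<noteq> 0"
proof -
  \<comment> \<open>The line through \<open>a\<close> at \<open>t = 0\<close> and \<open>b\<close>
    at \<open>t = 1\<close>.\<close>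
  define l where "l t = (\<lambda>i. a i + t * (b i - a i))" for t
  obtain p where p: "\<And>t. f (l t) = poly p t"
    using assms(1) unfolding line_poly_def l_def by metis
  obtain q where q: "\<And>t. g (l t) = poly q t"
    using assms(2) unfolding line_poly_def l_def by metis
  have "l 0 = a" "l 1 = b" by (auto simp: l_def)
  then have "p \<noteq> 0" "q \<noteq> 0" using assms(3,4) p[of 0] q[of 1] by auto
  then have "p * q \<noteq> 0" by simp
  then obtain t where "poly (p * q) t \<noteq> 0" using poly_all_0_iff_0 by blast
  then show ?thesis using p q by (metis poly_mult)
qed

text \<open>Induction on \<open>I\<close>: the product over the earlier indices serves as one of the
  two functions in \<open>line_poly_common_nonzero\<close>.\<close>

lemma line_poly_prod_nonzero:
  fixes f :: "'b \<Rightarrow> ('i \<Rightarrow> 'a :: {idom, ring_char_0}) \<Rightarrow> 'a"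
  assumes "finite I" and "\<And>a. a \<in> I \<Longrightarrow> line_poly (f a)" and "\<And>a. a \<in> I \<Longrightarrow> \<exists>x. f a x \<noteq> 0"
  shows "\<exists>x. \<forall>a\<in>I. f a x \<noteq> 0"
proof -
  have "\<exists>x. (\<Prod>a\<in>I. f a x) \<noteq> 0"
    using assms
  proof (induction I)
    case (insert a I)
    then obtain x y where "(\<Prod>a\<in>I. f a x) \<noteq> 0" "f a y \<noteq> 0" by blast
    moreover have "line_poly (\<lambda>x. \<Prod>a\<in>I. f a x)" "line_poly (f a)"
      using insert.prems by (auto intro: line_poly_prod)
    ultimately show ?case
      using line_poly_common_nonzero[of "f a" "\<lambda>x. \<Prod>a\<in>I. f a x"] insert.hyps by simp
  qed simp
  then show ?thesis using assms(1) by auto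
qed

section \<open>Isotropic vectors without zero entries\<close>

text \<open>The form is affine in each variable: \<open>2 * u k * g u + h u\<close>, where \<open>g\<close> and \<open>h\<close> do not involve
  \<open>u k\<close>. If \<open>k\<close> avoids a nonzero entry \<open>(a, b)\<close>, then \<open>g\<close> and \<open>h\<close> are both nonzero polynomials,
  and the solution \<open>u k = - h u / (2 * g u)\<close> is generically nonzero.\<close>

lemma nowhere_zero_isotropic:
  fixes q :: "nat \<Rightarrow> nat \<Rightarrow> real"
  assumes n: "n \<ge> 3"
    and sym: "\<And>i j. i < n \<Longrightarrow> j < n \<Longrightarrow> q i j = q j i"
    and diag: "\<And>i. i < n \<Longrightarrow> q i i = 0"
    and row: "\<And>i. i < n \<Longrightarrow> \<exists>j<n. q i j \<noteq> 0"
  shows "\<exists>u. (\<forall>i. u i \<noteq> 0) \<and> (\<Sum>i<n. \<Sum>j<n. u i * q i j * u j) = 0"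
proof -
  obtain b where b: "b < n" "q 0 b \<noteq> 0" using row[of 0] n by auto
  have b0: "b \<noteq> 0" by (rule notI) (use b diag[of 0] n in simp)
  \<comment> \<open>Order at least 3 enters here: \<open>k\<close> is a third index besides
    \<open>0\<close> and \<open>b\<close>.\<close>
  define k :: nat where "k = (if b = 1 then 2 else 1)"
  have k: "k < n" "k \<noteq> 0" "k \<noteq> b" using n by (auto simp: k_def)
  obtain m where m: "m < n" "q k m \<noteq> 0" using row[OF k(1)] by auto
  have mk: "m \<noteq> k" by (rule notI) (use m diag in simp)
  define K where "K = {..<n} - {k}"
  have K: "finite K" "{..<n} = insert k K" "k \<notin> K" using k by (auto simp: K_def)
  define g where "g u = (\<Sum>j\<in>K. q k j * u j)" for u :: "nat \<Rightarrow> real"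
  define h where "h u = (\<Sum>i\<in>K. \<Sum>j\<in>K. u i * q i j * u j)" for u :: "nat \<Rightarrow> real"
  have expand: "(\<Sum>i<n. \<Sum>j<n. u i * q i j * u j) = h u + 2 * u k * g u" for u
  proof -
    have "(\<Sum>i\<in>K. u i * q i k * u k) = u k * g u"
      unfolding g_def sum_distrib_left
      by (intro sum.cong refl) (use sym k in \<open>auto simp: K_def\<close>)
    moreover have "(\<Sum>j\<in>K. u k * q k j * u j) = u k * g u"
      by (simp add: g_def sum_distrib_left ac_simps)
    ultimately show ?thesis
      using K diag[OF k(1)] by (simp add: sum.distrib h_def)
  qed
  have g_line: "line_poly g" and h_line: "line_poly h"
    unfolding g_def h_def
    by (intro line_poly_sum line_poly_mult line_poly_const line_poly_coord)+
  have g_nz: "\<exists>u. g u \<noteq> 0"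
    by (rule exI[of _ "\<lambda>i. if i = m then 1 else 0"])
      (use m mk in \<open>simp add: g_def K_def if_distrib[of "\<lambda>x. _ * x"] cong: if_cong\<close>)
  have h_nz: "\<exists>u. h u \<noteq> 0"
  proof (rule exI)
    \<comment> \<open>The sum of the unit vectors at \<open>0\<close> and \<open>b\<close>, both in
      \<open>K\<close>; there \<open>h\<close> takes the value \<open>2 * q 0 b\<close>.\<close>
    let ?u = "\<lambda>i. (if i = 0 then 1 else 0) + (if i = b then 1 else 0) :: real"
    have "(\<Sum>j\<in>K. ?u i * q i j * ?u j) = ?u i * (q i 0 + q i b)" for i
      using k b by (simp add: K_def sum.distrib distrib_left if_distrib[of "\<lambda>x. _ * x"] cong: if_cong)
    then have "h ?u = (q 0 0 + q 0 b) + (q b 0 + q b b)"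
      using k b by (simp add: h_def K_def sum.distrib distrib_right if_distrib[of "\<lambda>x. x * _"] cong: if_cong)
    then show "h ?u \<noteq> 0" using b k diag sym[of b 0] by simp
  qed
  \<comment> \<open>\<open>g u\<close> will be a denominator, \<open>h u\<close> makes the new entry
    at \<open>k\<close> nonzero, and the coordinates keep the other entries nonzero.\<close>
  define F where "F = insert g (insert h ((\<lambda>i u. u i) ` {..<n}))"
  have "\<exists>u. \<forall>f\<in>F. f u \<noteq> 0"
  proof (rule line_poly_prod_nonzero)
    show "finite F" by (simp add: F_def)
    show "line_poly f" if "f \<in> F" for f
      using that g_line h_line line_poly_coord by (auto simp: F_def)
    show "\<exists>u. f u \<noteq> 0" if "f \<in> F" for f
      using that g_nz h_nz by (auto simp: F_def intro: exI[of _ "\<lambda>_. 1"])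
  qed
  then obtain u where u: "g u \<noteq> 0" "h u \<noteq> 0" "\<And>i. i < n \<Longrightarrow> u i \<noteq> 0"
    by (auto simp: F_def)
  \<comment> \<open>Only the entry at \<open>k\<close> changes below \<open>n\<close>, so
    \<open>g\<close> and \<open>h\<close> keep their values. The value 1 from \<open>n\<close> on
    serves the quantifier over all indices.\<close>
  define w where "w i = (if i = k then - h u / (2 * g u) else if i < n then u i else 1)" for i
  have gh: "g w = g u" "h w = h u"
    by (auto simp: g_def h_def w_def K_def intro!: sum.cong)
  have wk: "w k = - h u / (2 * g u)" by (simp add: w_def)
  have "(\<Sum>i<n. \<Sum>j<n. w i * q i j * w j) = 0"
    unfolding expand gh wk using u by simp
  moreover have "\<forall>i. w i \<noteq> 0" using u by (auto simp: w_def)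
  ultimately show ?thesis by blast
qed

text \<open>The inverse of a symmetric matrix is symmetric, and a zero row \<open>i\<close> of
  \<open>Q\<close> would make entry \<open>(i, i)\<close> of \<open>Q * A\<close> vanish.\<close>

lemma nowhere_zero_isotropic_inverse:
  fixes A Q :: "real mat"
  assumes n: "n \<ge> 3"
    and A: "A \<in> carrier_mat n n" and sym: "transpose_mat A = A"
    and Q: "Q \<in> carrier_mat n n" and AQ: "A * Q = 1\<^sub>m n"
    and diag: "\<forall>i<n. Q $$ (i, i) = 0"
  shows "\<exists>u. (\<forall>i. u i \<noteq> 0) \<and> (\<Sum>i<n. \<Sum>j<n. u i * Q $$ (i, j) * u j) = 0"
proof (rule nowhere_zero_isotropic[OF n])
  have QA: "Q * A = 1\<^sub>m n" by (rule mat_mult_left_right_inverse[OF A Q AQ])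
  have "transpose_mat Q = transpose_mat Q * (A * Q)" using AQ Q by simp
  also have "\<dots> = transpose_mat (A * Q) * Q"
    using A Q by (simp add: transpose_mult[of A n n Q n] sym assoc_mult_mat[of _ n n A n Q n])
  also have "\<dots> = Q" using AQ Q by simp
  finally have QT: "transpose_mat Q = Q" .
  show "Q $$ (i, j) = Q $$ (j, i)" if "i < n" "j < n" for i j
    using that Q arg_cong[OF QT, of "\<lambda>M. M $$ (i, j)"] by simp
  show "Q $$ (i, i) = 0" if "i < n" for i using diag that by simp
  show "\<exists>j<n. Q $$ (i, j) \<noteq> 0" if i: "i < n" for i
  proof (rule ccontr)
    assume "\<not> (\<exists>j<n. Q $$ (i, j) \<noteq> 0)"
    then have "(Q * A) $$ (i, i) = 0"
      using A Q i by (auto simp: scalar_prod_def)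
    then show False using QA i by simp
  qed
qed

section \<open>Inverse of the bordered block matrix\<close>

text \<open>Entry \<open>(a, b)\<close> of the product is \<open>u a * u b\<close> times the value
  of the form of \<open>R\<close> at \<open>v\<close>.\<close>

lemma rank_one_conjugate_eq_0:
  fixes R :: "'a :: comm_ring_1 mat"
  assumes R: "R \<in> carrier_mat m m"
    and iso: "(\<Sum>i<m. \<Sum>j<m. v i * R $$ (i, j) * v j) = 0"
  shows "mat n m (\<lambda>(i, j). u i * v j) * R * mat m n (\<lambda>(i, j). v i * u j) = 0\<^sub>m n n"
proof (rule eq_matI)
  fix a b assume ab: "a < dim_row (0\<^sub>m n n :: 'a mat)" "b < dim_col (0\<^sub>m n n :: 'a mat)"
  have "(mat n m (\<lambda>(i, j). u i * v j) * R * mat m n (\<lambda>(i, j). v i * u j)) $$ (a, b)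
      = (\<Sum>j<m. (\<Sum>i<m. u a * v i * R $$ (i, j)) * (v j * u b))"
    using ab R by (simp add: scalar_prod_def lessThan_atLeast0)
  also have "\<dots> = u a * u b * (\<Sum>j<m. \<Sum>i<m. v i * R $$ (i, j) * v j)"
    by (simp add: sum_distrib_left sum_distrib_right ac_simps)
  also have "(\<Sum>j<m. \<Sum>i<m. v i * R $$ (i, j) * v j) = (\<Sum>i<m. \<Sum>j<m. v i * R $$ (i, j) * v j)"
    by (rule sum.swap)
  finally show "(mat n m (\<lambda>(i, j). u i * v j) * R * mat m n (\<lambda>(i, j). v i * u j)) $$ (a, b)
      = 0\<^sub>m n n $$ (a, b)"
    using iso ab by simp
qed (use R in auto)

text \<open>The Schur complements \<open>A - C * R * D\<close> and \<open>B - D * Q * C\<close>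
  reduce to \<open>A\<close> and \<open>B\<close>, so the usual block inverse has \<open>Q\<close>
  and \<open>R\<close> on its diagonal.\<close>

lemma four_block_inverse:
  fixes A B :: "'a :: comm_ring_1 mat"
  assumes A: "A \<in> carrier_mat n n" and Q: "Q \<in> carrier_mat n n" and AQ: "A * Q = 1\<^sub>m n"
    and B: "B \<in> carrier_mat m m" and R: "R \<in> carrier_mat m m" and BR: "B * R = 1\<^sub>m m"
    and C: "C \<in> carrier_mat n m" and D: "D \<in> carrier_mat m n"
    and CRD: "C * R * D = 0\<^sub>m n n" and DQC: "D * Q * C = 0\<^sub>m m m"
  shows "four_block_mat A C D B * four_block_mat Q (- (Q * C * R)) (- (R * D * Q)) R = 1\<^sub>m (n + m)"
proof -
  define S where "S = C * R"
  define T where "T = D * Q"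
  define X where "X = Q * C * R"
  define Y where "Y = R * D * Q"
  have carr: "S \<in> carrier_mat n m" "T \<in> carrier_mat m n"
    "X \<in> carrier_mat n m" "Y \<in> carrier_mat m n"
    using Q C R D by (auto simp: S_def T_def X_def Y_def)
  have X: "X = Q * S" unfolding X_def S_def by (rule assoc_mult_mat[OF Q C R])
  have Y: "Y = R * T" unfolding Y_def T_def by (rule assoc_mult_mat[OF R D Q])
  have AX: "A * X = S"
    unfolding X assoc_mult_mat[OF A Q carr(1), symmetric] AQ by (rule left_mult_one_mat[OF carr(1)])
  have BY: "B * Y = T"
    unfolding Y assoc_mult_mat[OF B R carr(2), symmetric] BR by (rule left_mult_one_mat[OF carr(2)])
  \<comment> \<open>Regrouping turns \<open>C * Y\<close> into \<open>(C * R * D) * Q\<close> and,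
    below, \<open>D * X\<close> into \<open>(D * Q * C) * R\<close>.\<close>
  have "C * Y = S * D * Q"
    unfolding Y assoc_mult_mat[OF C R carr(2), symmetric] unfolding S_def[symmetric] T_def
    by (rule assoc_mult_mat[OF carr(1) D Q, symmetric])
  also have "\<dots> = 0\<^sub>m n n"
    unfolding S_def CRD by (rule left_mult_zero_mat[OF Q])
  finally have CY: "C * Y = 0\<^sub>m n n" .
  have "D * X = T * C * R"
    unfolding X assoc_mult_mat[OF D Q carr(1), symmetric] unfolding T_def[symmetric] S_def
    by (rule assoc_mult_mat[OF carr(2) C R, symmetric])
  also have "\<dots> = 0\<^sub>m m m"
    unfolding T_def DQC by (rule left_mult_zero_mat[OF R])
  finally have DX: "D * X = 0\<^sub>m m m" .
  have "- 0\<^sub>m k l = (0\<^sub>m k l :: 'a mat)" for k l by (intro eq_matI) auto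
  then have neg: "A * - X = - S" "B * - Y = - T" "C * - Y = 0\<^sub>m n n" "D * - X = 0\<^sub>m m m"
    using A B C D carr AX BY CY DX by simp_all
  have "four_block_mat A C D B * four_block_mat Q (- X) (- Y) R =
      four_block_mat (1\<^sub>m n + 0\<^sub>m n n) (- S + S) (T + - T) (0\<^sub>m m m + 1\<^sub>m m)"
    using carr
    by (simp add: mult_four_block_mat[OF A C D B Q _ _ R] neg AQ BR flip: S_def T_def)
  also have "\<dots> = 1\<^sub>m (n + m)"
    using carr by (simp add: comm_add_mat[of T m n "- T"])
  finally show ?thesis by (simp only: X_def Y_def)
qed

section \<open>The matrix of the join\<close>

theorem theorem3p2:
  fixes G1 G2 :: "'a pair_pre_digraph"
  assumes "pair_graph G1" and "pair_graph G2"
    and "pverts G1 \<inter> pverts G2 = {}"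
    and "card (pverts G1) \<ge> 3" and "card (pverts G2) \<ge> 3"
    and "has_property_P G1" and "has_property_P G2"
  shows "has_property_P (graph_join G1 G2)"
proof -
  interpret G1: pair_graph G1 by fact
  interpret G2: pair_graph G2 by fact
  obtain vs A Q where vs: "distinct vs" "set vs = pverts G1" and A: "A \<in> sym_matrices G1 vs"
    and Q: "Q \<in> carrier_mat (length vs) (length vs)" "A * Q = 1\<^sub>m (length vs)"
      "\<forall>i<length vs. Q $$ (i, i) = 0"
    using assms(6) unfolding has_property_P_iff by blast
  obtain ws B R where ws: "distinct ws" "set ws = pverts G2" and B: "B \<in> sym_matrices G2 ws"
    and R: "R \<in> carrier_mat (length ws) (length ws)" "B * R = 1\<^sub>m (length ws)"
      "\<forall>i<length ws. R $$ (i, i) = 0"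
    using assms(7) unfolding has_property_P_iff by blast
  define n where "n = length vs"
  define m where "m = length ws"
  note Q = Q[folded n_def] and R = R[folded m_def]
  have n: "n \<ge> 3" using assms(4) vs by (metis distinct_card n_def)
  have m: "m \<ge> 3" using assms(5) ws by (metis distinct_card m_def)
  have AC: "A \<in> carrier_mat n n" "transpose_mat A = A"
    using A by (auto simp: sym_matrices_def n_def)
  have BC: "B \<in> carrier_mat m m" "transpose_mat B = B"
    using B by (auto simp: sym_matrices_def m_def)
  obtain u where u: "\<And>i. u i \<noteq> 0" "(\<Sum>i<n. \<Sum>j<n. u i * Q $$ (i, j) * u j) = 0"
    using nowhere_zero_isotropic_inverse[OF n AC Q] by blast
  obtain v where v: "\<And>i. v i \<noteq> 0" "(\<Sum>i<m. \<Sum>j<m. v i * R $$ (i, j) * v j) = 0"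
    using nowhere_zero_isotropic_inverse[OF m BC R] by blast
  \<comment> \<open>As \<open>u\<close> and \<open>v\<close> vanish nowhere, every entry of
    \<open>C\<close> and \<open>D\<close> is nonzero, matching the complete adjacency across the
    join.\<close>
  define C where "C = mat n m (\<lambda>(i, j). u i * v j)"
  define D where "D = mat m n (\<lambda>(i, j). v i * u j)"
  have CD: "C \<in> carrier_mat n m" "D \<in> carrier_mat m n" by (auto simp: C_def D_def)
  have CT: "transpose_mat C = D" "transpose_mat D = C"
    by (auto simp: C_def D_def intro!: eq_matI)
  define M where "M = four_block_mat A C D B"
  define N where "N = four_block_mat Q (- (Q * C * R)) (- (R * D * Q)) R"
  have "C * R * D = 0\<^sub>m n n" "D * Q * C = 0\<^sub>m m m"
    unfolding C_def D_def using rank_one_conjugate_eq_0 Q(1) R(1) u(2) v(2) by blast+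
  then have MN: "M * N = 1\<^sub>m (n + m)"
    unfolding M_def N_def using AC BC Q R CD by (intro four_block_inverse) auto
  have NC: "N \<in> carrier_mat (n + m) (n + m)" using Q R by (simp add: N_def)
  have diag: "\<forall>i<n + m. N $$ (i, i) = 0" using Q R by (auto simp: N_def)
  have Mij: "M $$ (i, j) \<noteq> 0 \<longleftrightarrow> ((vs @ ws) ! i, (vs @ ws) ! j) \<in> parcs (graph_join G1 G2)"
    if ij: "i < n + m" "j < n + m" "i \<noteq> j" for i j
  proof -
    have V: "x \<in> pverts G1 \<Longrightarrow> x \<notin> pverts G2" for x using assms(3) by blast
    have vsi: "vs ! i \<in> pverts G1" if "i < n" for i using that unfolding vs(2)[symmetric] n_def by (rule nth_mem)
    have wsi: "ws ! i \<in> pverts G2" if "i < m" for i using that unfolding ws(2)[symmetric] m_def by (rule nth_mem)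
    have arcs: "x \<in> pverts G1 \<and> y \<in> pverts G1" if "(x, y) \<in> parcs G1" for x y
      using G1.in_arcsD1[OF that] G1.in_arcsD2[OF that] by simp
    have arcs': "x \<in> pverts G2 \<and> y \<in> pverts G2" if "(x, y) \<in> parcs G2" for x y
      using G2.in_arcsD1[OF that] G2.in_arcsD2[OF that] by simp
    have MM: "M $$ (i, j) = (if i < n then if j < n then A $$ (i, j) else u i * v (j - n)
        else if j < n then v (i - n) * u j else B $$ (i - n, j - n))"
      using ij AC BC by (auto simp: M_def C_def D_def)
    have VW: "(vs @ ws) ! k = (if k < n then vs ! k else ws ! (k - n))" for k
      by (simp add: nth_append n_def)
    have J: "(x, y) \<in> parcs (graph_join G1 G2) \<longleftrightarrow> (x, y) \<in> parcs G1 \<or> (x, y) \<in> parcs G2 \<or>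
        x \<in> pverts G1 \<and> y \<in> pverts G2 \<or> x \<in> pverts G2 \<and> y \<in> pverts G1" for x y
      by (simp add: graph_join_def)
    have AA: "A $$ (i, j) \<noteq> 0 \<longleftrightarrow> (vs ! i, vs ! j) \<in> parcs G1" if "i < n" "j < n" "i \<noteq> j" for i j
      using A that unfolding sym_matrices_def n_def by blast
    have BB: "B $$ (i, j) \<noteq> 0 \<longleftrightarrow> (ws ! i, ws ! j) \<in> parcs G2" if "i < m" "j < m" "i \<noteq> j" for i j
      using B that unfolding sym_matrices_def m_def by blast
    \<comment> \<open>In the diagonal blocks, disjointness of the vertex sets excludes cross arcs
      and arcs of the other graph.\<close>
    consider "i < n" "j < n" | "i < n" "j \<ge> n" | "i \<ge> n" "j < n" | "i \<ge> n" "j \<ge> n" by linarith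
    then show ?thesis
    proof cases
      case 1
      then have "(vs ! i, vs ! j) \<in> parcs (graph_join G1 G2) \<longleftrightarrow> (vs ! i, vs ! j) \<in> parcs G1"
        unfolding J using vsi V arcs' by blast
      with 1 AA ij(3) show ?thesis by (simp add: MM VW)
    next
      case 2
      then have "(vs ! i, ws ! (j - n)) \<in> parcs (graph_join G1 G2)"
        unfolding J using vsi[of i] wsi[of "j - n"] ij by simp
      with 2 u(1) v(1) show ?thesis by (simp add: MM VW)
    next
      case 3
      then have "(ws ! (i - n), vs ! j) \<in> parcs (graph_join G1 G2)"
        unfolding J using wsi[of "i - n"] vsi[of j] ij by simp
      with 3 u(1) v(1) show ?thesis by (simp add: MM VW)
    next
      case 4
      then have k: "i - n < m" "j - n < m" "i - n \<noteq> j - n" using ij by auto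
      then have "(ws ! (i - n), ws ! (j - n)) \<in> parcs (graph_join G1 G2) \<longleftrightarrow>
          (ws ! (i - n), ws ! (j - n)) \<in> parcs G2"
        unfolding J using wsi V arcs by blast
      with 4 BB[OF k] show ?thesis by (simp add: MM VW)
    qed
  qed
  have "transpose_mat M = M"
    unfolding M_def transpose_four_block_mat[OF AC(1) CD BC(1)] by (simp add: AC BC CT)
  moreover have "M \<in> carrier_mat (n + m) (n + m)" using AC BC by (simp add: M_def)
  ultimately have "M \<in> sym_matrices (graph_join G1 G2) (vs @ ws)"
    using Mij by (auto simp: sym_matrices_def n_def m_def)
  moreover have "distinct (vs @ ws)" "set (vs @ ws) = pverts (graph_join G1 G2)"
    using vs ws assms(3) by (auto simp: graph_join_def)
  ultimately show ?thesis
    unfolding has_property_P_iff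
    by (intro exI[of _ "vs @ ws"] exI[of _ M] exI[of _ N] conjI)
      (use MN NC diag in \<open>simp_all add: n_def m_def\<close>)
qed

end
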